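(* Let $a,b>0$. On $\left(S^7=\frac{\mathrm{Sp}(2)\mathrm{Sp}(1)}{\mathrm{Sp}(1)\mathrm{Sp}(1)},g_{a,b}\right)$ the invariant spinor $\psi_0=\frac1{\sqrt2}(y_2\wedge y_3+iy_1)$ is a generalized Killing spinor, $\nabla^{g_{a,b}}_X\psi_0=A(X)\cdot\psi_0$, for the endomorphism $$A=\frac{2a-5b}{4b\sqrt{30a}}\,\mathrm{Id}|_{\mathfrak m_1}-\frac{\sqrt{3a}}{4b\sqrt{10}}\,\mathrm{Id}|_{\mathfrak m_2},$$ and it is a Riemannian Killing spinor if and only if $a=b$ (equivalently, if and only if $g_{a,b}$ is a multiple of the second Einstein metric $g_{1/24,1/24}$).
   Context: Matrices are $2\times2$ over the quaternions. $E_{1,2}$ has $-1$ in position $(1,2)$, $+1$ in $(2,1)$; $F_{1,2}$ has $1$ in both; $F_{i,i}$ has $1$ in $(i,i)$; other entries zero. $\mathfrak g=\mathfrak{sp}(2)\oplus\mathfrak{sp}(1)$, isotropy algebra $\mathfrak h=\mathrm{span}_{\mathbb R}\{(qF_{2,2},0),(qF_{1,1},q):q=i,j,k\}$, $\kappa((A,z),(A',z'))=12\,\mathrm{Re}\,\mathrm{tr}(AA')+8\,\mathrm{Re}(zz')$, $\mathfrak m=\mathfrak h^{\perp_\kappa}=\mathfrak m_1\oplus\mathfrak m_2$, $g_{a,b}=-a\kappa|_{\mathfrak m_1\times\mathfrak m_1}-b\kappa|_{\mathfrak m_2\times\mathfrak m_2}$, with orthonormal basis $e_1=\frac1{\sqrt{30a}}(iF_{1,1},-\frac32i)$,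 $e_2=\frac1{\sqrt{30a}}(-kF_{1,1},\frac32k)$, $e_3=\frac1{\sqrt{30a}}(jF_{1,1},-\frac32j)$ of $\mathfrak m_1$ and $e_4=\frac1{\sqrt{24b}}(jF_{1,2},0)$, $e_5=\frac1{\sqrt{24b}}(kF_{1,2},0)$, $e_6=\frac1{\sqrt{24b}}(iF_{1,2},0)$, $e_7=\frac1{\sqrt{24b}}(E_{1,2},0)$ of $\mathfrak m_2$. The round metric is $g_{5/24,1/24}$; the second Einstein metric $g_{1/24,1/24}$ is obtained from it by rescaling by $\frac15$ on $\mathfrak m_1$. Spin module: $x_j=\frac1{\sqrt2}(e_{2j}-ie_{2j+1})$, $y_j=\frac1{\sqrt2}(e_{2j}+ie_{2j+1})$ ($j=1,2,3$), $\Sigma=\Lambda^\bullet\mathrm{span}_{\mathbb C}\{y_1,y_2,y_3\}$, $e_{2j}\cdot\eta=i(x_j\lrcorner\eta+y_j\wedge\eta)$, $e_{2j+1}\cdot\eta=y_j\wedge\eta-x_j\lrcorner\eta$, $e_1\cdot\eta=i\eta$ (even degree), $-i\eta$ (odd degree), $x_j\lrcorner$ the antiderivation with $x_j\lrcorner y_k=\delta_{jk}$. The spin lift of $e_i\wedge e_j$ ($e_i\mapsto e_j$, $e_j\mapsto-e_i$) is $\frac12e_i\cdot e_j$. Invariant spinor fields are identified with elements of $\Sigma$ annihilated by the spin lifts of $\mathrm{ad}(h)|_{\mathfrak m}$, $h\in\mathfrak h$; for these, at the origin $\nabla^g_X\psi=\widetilde{\Lambda^g(X)}\cdot\psi$,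 with $\Lambda^g(X)Y=\frac12[X,Y]_{\mathfrak m}+U(X,Y)$, $2g(U(X,Y),Z)=g([Z,X]_{\mathfrak m},Y)+g(X,[Z,Y]_{\mathfrak m})$. Generalized Killing: $\nabla^g_X\psi=A(X)\cdot\psi$ with $A$ symmetric; Riemannian Killing: $A$ a constant multiple of the identity. *)

theory Defs
  imports "HOL-Analysis.Analysis"
begin

section \<open>Quaternions\<close>

datatype quat = Quat (qRe: real) (qI: real) (qJ: real) (qK: real)

lemma quat_eq_iff:
  "p = q \<longleftrightarrow> qRe p = qRe q \<and> qI p = qI q \<and> qJ p = qJ q \<and> qK p = qK q"
  by (cases p; cases q) simp

instantiation quat :: real_algebra_1
begin

definition "0 = Quat 0 0 0 0"
definition "1 = Quat 1 0 0 0"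
definition "p + q = Quat (qRe p + qRe q) (qI p + qI q) (qJ p + qJ q) (qK p + qK q)"
definition "- p = Quat (- qRe p) (- qI p) (- qJ p) (- qK p)"
definition "p - q = Quat (qRe p - qRe q) (qI p - qI q) (qJ p - qJ q) (qK p - qK q)"
definition "r *\<^sub>R p = Quat (r * qRe p) (r * qI p) (r * qJ p) (r * qK p)"
definition "p * q =
  Quat (qRe p * qRe q - qI p * qI q - qJ p * qJ q - qK p * qK q)
       (qRe p * qI q + qI p * qRe q + qJ p * qK q - qK p * qJ q)
       (qRe p * qJ q - qI p * qK q + qJ p * qRe q + qK p * qI q)
       (qRe p * qK q + qI p * qJ q - qJ p * qI q + qK p * qRe q)"

instance
  by standard
    (simp_all add: quat_eq_iff zero_quat_def one_quat_def plus_quat_def uminus_quat_def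
      minus_quat_def scaleR_quat_def times_quat_def algebra_simps)

end

definition qi :: quat where "qi = Quat 0 1 0 0"
definition qj :: quat where "qj = Quat 0 0 1 0"
definition qk :: quat where "qk = Quat 0 0 0 1"

definition qcnj :: "quat \<Rightarrow> quat" where
  "qcnj q = Quat (qRe q) (- qI q) (- qJ q) (- qK q)"

lemma quat_unit_products:
  "qi * qi = -1" "qj * qj = -1" "qk * qk = -1"
  "qi * qj = qk" "qj * qk = qi" "qk * qi = qj"
  "qj * qi = - qk" "qk * qj = - qi" "qi * qk = - qj"
  by (simp_all add: quat_eq_iff qi_def qj_def qk_def times_quat_def one_quat_def uminus_quat_def)


section \<open>The Lie algebra \<open>sp(2) \<oplus> sp(1)\<close>\<close>

type_synonym lie = "(quat^2^2) \<times> quat"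

definition conj_transpose :: "quat^2^2 \<Rightarrow> quat^2^2" where
  "conj_transpose A = (\<chi> r s. qcnj (A $ s $ r))"

definition lie_g :: "lie set" where
  "lie_g = {(A, z). conj_transpose A = - A \<and> qcnj z = - z}"

definition bracket :: "lie \<Rightarrow> lie \<Rightarrow> lie" where
  "bracket X Y = (fst X ** fst Y - fst Y ** fst X, snd X * snd Y - snd Y * snd X)"

definition qF :: "quat \<Rightarrow> 2 \<Rightarrow> 2 \<Rightarrow> quat^2^2" (* the matrix q F_{r,s} *) where
  "qF q r s = (\<chi> m n. if (m, n) = (r, s) \<or> (m, n) = (s, r) then q else 0)"

definition E12 :: "quat^2^2" where
  "E12 = (\<chi> m n. if (m, n) = (1, 2) then -1 else if (m, n) = (2, 1) then 1 else 0)"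

definition lie_h :: "lie set" where
  "lie_h = span ({(qF q 2 2, 0) | q. q \<in> {qi, qj, qk}} \<union> {(qF q 1 1, q) | q. q \<in> {qi, qj, qk}})"

definition kappa :: "lie \<Rightarrow> lie \<Rightarrow> real" where
  "kappa X Y = 12 * qRe (trace (fst X ** fst Y)) + 8 * qRe (snd X * snd Y)"

definition lie_m :: "lie set" where
  "lie_m = {X \<in> lie_g. \<forall>H\<in>lie_h. kappa X H = 0}"

(* m_1 and m_2 are the spans of the orthonormal vectors e_1, ..., e_3 and e_4, ..., e_7 below,
   without the normalising factors. *)
definition lie_m1 :: "lie set" where
  "lie_m1 = span {(qF q 1 1, (- (3/2)) *\<^sub>R q) | q. q \<in> {qi, qj, qk}}"

definition lie_m2 :: "lie set" where
  "lie_m2 = span {(qF qj 1 2, 0), (qF qk 1 2, 0), (qF qi 1 2, 0), (E12, 0)}"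

(* The projections for the direct sums g = h + m and m = m_1 + m_2; meaningful on g, resp. m. *)
definition proj_m :: "lie \<Rightarrow> lie" where
  "proj_m X = (THE Y. Y \<in> lie_m \<and> X - Y \<in> lie_h)"

definition proj_m1 :: "lie \<Rightarrow> lie" where
  "proj_m1 X = (THE Y. Y \<in> lie_m1 \<and> X - Y \<in> lie_m2)"

definition proj_m2 :: "lie \<Rightarrow> lie" where
  "proj_m2 X = (THE Y. Y \<in> lie_m2 \<and> X - Y \<in> lie_m1)"


section \<open>The invariant metrics and their Levi-Civita connections\<close>

definition inv_metric :: "real \<Rightarrow> real \<Rightarrow> lie \<Rightarrow> lie \<Rightarrow> real" where
  "inv_metric a b X Y =
     - a * kappa (proj_m1 X) (proj_m1 Y) - b * kappa (proj_m2 X) (proj_m2 Y)"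

(* the round metric inv_metric (5/24) (1/24), rescaled by 1/5 on m_1 *)
definition second_einstein_metric :: "lie \<Rightarrow> lie \<Rightarrow> real" where
  "second_einstein_metric = inv_metric (1/24) (1/24)"

definition onb :: "real \<Rightarrow> real \<Rightarrow> lie list" where
  "onb a b =
    [(1 / sqrt (30 * a)) *\<^sub>R (qF qi 1 1, (- (3/2)) *\<^sub>R qi),
     (1 / sqrt (30 * a)) *\<^sub>R (- qF qk 1 1, (3/2) *\<^sub>R qk),
     (1 / sqrt (30 * a)) *\<^sub>R (qF qj 1 1, (- (3/2)) *\<^sub>R qj),
     (1 / sqrt (24 * b)) *\<^sub>R (qF qj 1 2, 0),
     (1 / sqrt (24 * b)) *\<^sub>R (qF qk 1 2, 0),
     (1 / sqrt (24 * b)) *\<^sub>R (qF qi 1 2, 0),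
     (1 / sqrt (24 * b)) *\<^sub>R (E12, 0)]"

definition e_vec :: "real \<Rightarrow> real \<Rightarrow> nat \<Rightarrow> lie" (* e_1, ..., e_7 *) where
  "e_vec a b n = onb a b ! (n - 1)"

definition U_map :: "real \<Rightarrow> real \<Rightarrow> lie \<Rightarrow> lie \<Rightarrow> lie" where
  "U_map a b X Y = (THE V. V \<in> lie_m \<and> (\<forall>Z\<in>lie_m.
     2 * inv_metric a b V Z =
       inv_metric a b (proj_m (bracket Z X)) Y + inv_metric a b X (proj_m (bracket Z Y))))"

definition Lambda_map :: "real \<Rightarrow> real \<Rightarrow> lie \<Rightarrow> lie \<Rightarrow> lie" where
  "Lambda_map a b X Y = (1/2) *\<^sub>R proj_m (bracket X Y) + U_map a b X Y"


section \<open>The spin module\<close>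

(* The exterior algebra on y_1, y_2, y_3, in coordinates: the component at S belongs to the
   product of the y_j with j in S, taken in the order of the type 3. There 3 = 0 is the least
   element, so e.g. the basis element at {2, 3} is y_3 wedge y_2. Elements are therefore always
   written with the operators below, which do not depend on the order chosen. *)
type_synonym spinor = "complex ^ (3 set)"

definition vac :: spinor (* the unit 1 of the exterior algebra *) where
  "vac = axis {} 1"

definition ext_sign :: "3 \<Rightarrow> 3 set \<Rightarrow> complex" where
  "ext_sign j S = (-1) ^ card {k \<in> S. k < j}"

definition wedge :: "3 \<Rightarrow> spinor \<Rightarrow> spinor" (* y_j wedge eta *) where
  "wedge j \<eta> = (\<chi> S. if j \<in> S then ext_sign j S * \<eta> $ (S - {j}) else 0)"

definition contr :: "3 \<Rightarrow> spinor \<Rightarrow> spinor" (* x_j contracted into eta *) where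
  "contr j \<eta> = (\<chi> S. if j \<in> S then 0 else ext_sign j S * \<eta> $ (insert j S))"

lemma ext_sign_sq: "ext_sign j S * ext_sign j S = 1"
  by (simp add: ext_sign_def flip: power_add mult_2)

lemma ext_sign_insert:
  "k \<notin> S \<Longrightarrow> ext_sign j (insert k S) = (if k < j then - ext_sign j S else ext_sign j S)"
proof -
  assume k: "k \<notin> S"
  show ?thesis
  proof (cases "k < j")
    case True
    then have "{x \<in> insert k S. x < j} = insert k {x \<in> S. x < j}" by auto
    then show ?thesis using k True by (simp add: ext_sign_def)
  next
    case False
    then have "{x \<in> insert k S. x < j} = {x \<in> S. x < j}" by auto
    then show ?thesis using False by (simp add: ext_sign_def)
  qed
qed

lemma ext_sign_remove:
  "k \<in> S \<Longrightarrow> ext_sign j (S - {k}) = (if k < j then - ext_sign j S else ext_sign j S)"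
  using ext_sign_insert[of k "S - {k}" j] by (auto simp: insert_absorb split: if_splits)

lemma wedge_anticommute: "wedge j (wedge k \<eta>) = - wedge k (wedge j \<eta>)"
proof (cases "j = k")
  case True
  then show ?thesis by (simp add: vec_eq_iff wedge_def)
next
  case False
  have "S - {j} - {k} = S - {k} - {j}" for S by auto
  with False show ?thesis
    by (cases j k rule: linorder_cases) (simp_all add: vec_eq_iff wedge_def ext_sign_remove order_less_not_sym)
qed

lemma contr_vac: "contr j vac = 0"
  by (auto simp: vec_eq_iff contr_def vac_def axis_def)

(* contr j is the antiderivation with contr j (y_k) = delta_jk *)
lemma contr_wedge:
  "contr j (wedge k \<eta>) = (if j = k then \<eta> else 0) - wedge k (contr j \<eta>)"
proof (cases "j = k")
  case True
  have "ext_sign k (insert k S) = ext_sign k S" for S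
    by (cases "k \<in> S") (simp_all add: insert_absorb ext_sign_insert)
  with True show ?thesis
    by (simp add: vec_eq_iff wedge_def contr_def ext_sign_remove insert_absorb
        ext_sign_sq mult.assoc[symmetric])
next
  case False
  then have "insert j S - {k} = insert j (S - {k})" for S by auto
  with False show ?thesis
    by (cases j k rule: linorder_cases)
      (simp_all add: vec_eq_iff wedge_def contr_def ext_sign_insert ext_sign_remove order_less_not_sym)
qed

(* Clifford multiplication by e_n, n = 1, ..., 7: for n > 1 the index j is n div 2 *)
definition cliff_e :: "nat \<Rightarrow> spinor \<Rightarrow> spinor" where
  "cliff_e n \<eta> =
    (if n = 1 then (\<chi> S. (if even (card S) then \<i> else - \<i>) * \<eta> $ S)
     else if even n then \<i> *s (contr (of_nat (n div 2)) \<eta> + wedge (of_nat (n div 2)) \<eta>)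
     else wedge (of_nat (n div 2)) \<eta> - contr (of_nat (n div 2)) \<eta>)"

definition cliff :: "real \<Rightarrow> real \<Rightarrow> lie \<Rightarrow> spinor \<Rightarrow> spinor" where
  "cliff a b X \<eta> = (\<Sum>n=1..7. inv_metric a b X (e_vec a b n) *\<^sub>R cliff_e n \<eta>)"

(* A skew endomorphism T of m is the sum over m < n of g(T e_m, e_n) e_m wedge e_n, where
   e_m wedge e_n maps e_m to e_n and e_n to - e_m. *)
definition spin_lift :: "real \<Rightarrow> real \<Rightarrow> (lie \<Rightarrow> lie) \<Rightarrow> spinor \<Rightarrow> spinor" where
  "spin_lift a b T \<eta> =
    (\<Sum>m=1..7. \<Sum>n\<in>{m<..7}.
      inv_metric a b (T (e_vec a b m)) (e_vec a b n) *\<^sub>R ((1/2) *\<^sub>R cliff_e m (cliff_e n \<eta>)))"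

(* Invariant spinor fields, identified with their values at the origin. *)
definition invariant_spinors :: "real \<Rightarrow> real \<Rightarrow> spinor set" where
  "invariant_spinors a b = {\<psi>. \<forall>H\<in>lie_h. spin_lift a b (bracket H) \<psi> = 0}"

(* The spinorial Levi-Civita derivative of an invariant spinor field at the origin: the spin lift
   of the Nomizu map. By homogeneity it suffices to differentiate at the origin. *)
definition nabla :: "real \<Rightarrow> real \<Rightarrow> lie \<Rightarrow> spinor \<Rightarrow> spinor" where
  "nabla a b X \<psi> = spin_lift a b (Lambda_map a b X) \<psi>"

definition symmetric_endo :: "real \<Rightarrow> real \<Rightarrow> (lie \<Rightarrow> lie) \<Rightarrow> bool" where
  "symmetric_endo a b A \<longleftrightarrow>
     (\<forall>X\<in>lie_m. A X \<in> lie_m) \<and>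
     (\<forall>X\<in>lie_m. \<forall>Y\<in>lie_m. A (X + Y) = A X + A Y) \<and>
     (\<forall>X\<in>lie_m. \<forall>r. A (r *\<^sub>R X) = r *\<^sub>R A X) \<and>
     (\<forall>X\<in>lie_m. \<forall>Y\<in>lie_m. inv_metric a b (A X) Y = inv_metric a b X (A Y))"

definition generalized_killing_for :: "real \<Rightarrow> real \<Rightarrow> (lie \<Rightarrow> lie) \<Rightarrow> spinor \<Rightarrow> bool" where
  "generalized_killing_for a b A \<psi> \<longleftrightarrow>
     symmetric_endo a b A \<and> (\<forall>X\<in>lie_m. nabla a b X \<psi> = cliff a b (A X) \<psi>)"

definition riemannian_killing :: "real \<Rightarrow> real \<Rightarrow> spinor \<Rightarrow> bool" where
  "riemannian_killing a b \<psi> \<longleftrightarrow>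
     (\<exists>c::real. generalized_killing_for a b (\<lambda>X. c *\<^sub>R X) \<psi>)"

definition psi0 :: spinor where
  "psi0 = (1 / sqrt 2) *\<^sub>R (wedge 2 (wedge 3 vac) + \<i> *s wedge 1 vac)"

end

theory Submission
  imports Defs
begin

text \<open>
  In the coordinates below a tangent vector is a pair \<open>(p, w)\<close> of an imaginary quaternion \<open>p\<close> (its
  \<open>\<mm>\<^sub>1\<close>-part) and a quaternion \<open>w\<close> (its \<open>\<mm>\<^sub>2\<close>-part), and the metric is
  \<open>30a \<langle>p, q\<rangle> + 24b \<langle>w, v\<rangle>\<close>. Brackets, the tensor \<open>U\<close> and hence the Nomizu map become short
  quaternionic formulas (\<open>bracket_tangent\<close>, \<open>U_map_tangent\<close>, \<open>Lambda_map_tangent\<close>).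

  A real spinor in dimension seven determines a \<open>G\<^sub>2\<close>-structure. For \<open>psi0\<close> this takes the form
  \<open>e\<^sub>m \<cdot> e\<^sub>n \<cdot> psi0 = \<plusminus> e\<^sub>k \<cdot> psi0\<close> for \<open>m \<noteq> n\<close>, where \<open>\<plusminus> e\<^sub>k\<close> is the cross product of \<open>e\<^sub>m\<close> and \<open>e\<^sub>n\<close>
  (\<open>psi0_cross_product\<close>). So the spin lift of a skew endomorphism \<open>T\<close> sends \<open>psi0\<close> to the Clifford
  product of \<open>psi0\<close> with a vector that depends linearly on the matrix of \<open>T\<close>: seven linear forms in
  its entries, each with three terms (\<open>spin_lift_psi0\<close>). Everything then reduces to evaluating these
  forms.

  On the isotropy representation they all vanish, since the isotropy algebra lies in the stabilizer
  \<open>\<gg>\<^sub>2\<close> of \<open>psi0\<close>; this is invariance. On \<open>\<Lambda>(X)\<close> they return the coordinates of \<open>X\<close>, scaled by one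
  factor on \<open>\<mm>\<^sub>1\<close> and another on \<open>\<mm>\<^sub>2\<close>: these are the eigenvalues of \<open>A\<close> (\<open>nabla_psi0\<close>). Clifford
  multiplication by a nonzero vector is injective, so \<open>psi0\<close> is a Riemannian Killing spinor exactly if
  the two eigenvalues agree. Over the common denominator \<open>4b \<surd>(30a)\<close> their numerators are \<open>2a - 5b\<close>
  and \<open>- 3a\<close>, which agree exactly if \<open>a = b\<close>.
\<close>

section \<open>Coordinates on the Lie algebra\<close>

lemma quat_components:
  "qRe 0 = 0" "qI 0 = 0" "qJ 0 = 0" "qK 0 = 0"
  "qRe 1 = 1" "qI 1 = 0" "qJ 1 = 0" "qK 1 = 0"
  "qRe (p + q) = qRe p + qRe q" "qI (p + q) = qI p + qI q"
  "qJ (p + q) = qJ p + qJ q" "qK (p + q) = qK p + qK q"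
  "qRe (p - q) = qRe p - qRe q" "qI (p - q) = qI p - qI q"
  "qJ (p - q) = qJ p - qJ q" "qK (p - q) = qK p - qK q"
  "qRe (- p) = - qRe p" "qI (- p) = - qI p" "qJ (- p) = - qJ p" "qK (- p) = - qK p"
  "qRe (t *\<^sub>R p) = t * qRe p" "qI (t *\<^sub>R p) = t * qI p"
  "qJ (t *\<^sub>R p) = t * qJ p" "qK (t *\<^sub>R p) = t * qK p"
  "qRe (p * q) = qRe p * qRe q - qI p * qI q - qJ p * qJ q - qK p * qK q"
  "qI (p * q) = qRe p * qI q + qI p * qRe q + qJ p * qK q - qK p * qJ q"
  "qJ (p * q) = qRe p * qJ q - qI p * qK q + qJ p * qRe q + qK p * qI q"
  "qK (p * q) = qRe p * qK q + qI p * qJ q - qJ p * qI q + qK p * qRe q"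
  "qRe (qcnj p) = qRe p" "qI (qcnj p) = - qI p" "qJ (qcnj p) = - qJ p" "qK (qcnj p) = - qK p"
  "qRe qi = 0" "qI qi = 1" "qJ qi = 0" "qK qi = 0"
  "qRe qj = 0" "qI qj = 0" "qJ qj = 1" "qK qj = 0"
  "qRe qk = 0" "qI qk = 0" "qJ qk = 0" "qK qk = 1"
  by (simp_all add: zero_quat_def one_quat_def plus_quat_def minus_quat_def uminus_quat_def
      scaleR_quat_def times_quat_def qcnj_def qi_def qj_def qk_def)

text \<open>The Euclidean inner product of the quaternions, the real part of \<open>qcnj p * q\<close>.\<close>

definition qdot :: "quat \<Rightarrow> quat \<Rightarrow> real" where
  "qdot p q = qRe p * qRe q + qI p * qI q + qJ p * qJ q + qK p * qK q"

lemma qdot_diff_left: "qdot (p - p') q = qdot p q - qdot p' q"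
  by (simp add: qdot_def quat_components algebra_simps)

lemma qdot_scaleR_left: "qdot (t *\<^sub>R p) q = t * qdot p q"
  by (simp add: qdot_def quat_components algebra_simps)

text \<open>
  Entries \<open>p\<close>, \<open>r\<close> on the diagonal and \<open>w\<close> below it; the entry above the diagonal is then forced by
  anti-Hermitian symmetry, so imaginary \<open>p\<close>, \<open>r\<close>, \<open>z\<close> and arbitrary \<open>w\<close> parametrize the Lie algebra.
\<close>

definition g_elem :: "quat \<Rightarrow> quat \<Rightarrow> quat \<Rightarrow> quat \<Rightarrow> lie" where
  "g_elem p w r z =
    (\<chi> m n. if m = 1 then if n = 1 then p else - qcnj w else if n = 1 then w else r, z)"

text \<open>
  The factor \<open>-3/2\<close> makes \<open>tangent p w\<close> orthogonal to \<open>isotropy p r\<close>: \<open>kappa\<close> weights the first component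
  by 12 and the second by 8.
\<close>

definition tangent :: "quat \<Rightarrow> quat \<Rightarrow> lie" where
  "tangent p w = g_elem p w 0 (- (3/2) *\<^sub>R p)"

definition isotropy :: "quat \<Rightarrow> quat \<Rightarrow> lie" where
  "isotropy p r = g_elem p 0 r p"

lemma g_elem_eq_iff:
  "g_elem p w r z = g_elem p' w' r' z' \<longleftrightarrow> p = p' \<and> w = w' \<and> r = r' \<and> z = z'"
  by (auto simp: g_elem_def vec_eq_iff forall_2)

lemma g_elem_linear:
  "g_elem p w r z + g_elem p' w' r' z' = g_elem (p + p') (w + w') (r + r') (z + z')"
  "g_elem p w r z - g_elem p' w' r' z' = g_elem (p - p') (w - w') (r - r') (z - z')"
  "- g_elem p w r z = g_elem (- p) (- w) (- r) (- z)"
  "t *\<^sub>R g_elem p w r z = g_elem (t *\<^sub>R p) (t *\<^sub>R w) (t *\<^sub>R r) (t *\<^sub>R z)"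
  "0 = g_elem 0 0 0 0"
  by (auto simp: g_elem_def vec_eq_iff forall_2 quat_eq_iff quat_components zero_prod_def)

lemma lie_eq_g_elem:
  "X = g_elem p w r z \<longleftrightarrow>
    fst X $ 1 $ 1 = p \<and> fst X $ 1 $ 2 = - qcnj w \<and> fst X $ 2 $ 1 = w \<and> fst X $ 2 $ 2 = r \<and> snd X = z"
  by (cases X) (auto simp: g_elem_def vec_eq_iff forall_2)

lemma qcnj_eq_uminus_iff: "qcnj p = - p \<longleftrightarrow> qRe p = 0"
  by (auto simp: quat_eq_iff quat_components)

lemma mem_lie_g:
  "X \<in> lie_g \<longleftrightarrow> (\<exists>p w r z. X = g_elem p w r z \<and> qRe p = 0 \<and> qRe r = 0 \<and> qRe z = 0)"
proof -
  have "qcnj u = - v \<longleftrightarrow> v = - qcnj u" "qcnj v = - u \<longleftrightarrow> v = - qcnj u" for u v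
    by (auto simp: quat_eq_iff quat_components)
  then have "X \<in> lie_g \<longleftrightarrow> qRe (fst X $ 1 $ 1) = 0 \<and> fst X $ 1 $ 2 = - qcnj (fst X $ 2 $ 1) \<and>
      qRe (fst X $ 2 $ 2) = 0 \<and> qRe (snd X) = 0"
    \<comment> \<open>The off-diagonal condition appears twice, once from each entry.\<close>
    by (cases X) (auto simp: lie_g_def conj_transpose_def vec_eq_iff forall_2
        simp flip: qcnj_eq_uminus_iff)
  then show ?thesis
    unfolding lie_eq_g_elem by blast
qed

lemma qF_E12_g_elem:
  "(qF q 1 1, z) = g_elem q 0 0 z"
  "(qF q 2 2, z) = g_elem 0 0 q z"
  "qRe q = 0 \<Longrightarrow> (qF q 1 2, z) = g_elem 0 q 0 z"
  "(- qF q 1 1, z) = g_elem (- q) 0 0 z"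
  "(E12, z) = g_elem 0 1 0 z"
  by (auto simp: qF_def E12_def g_elem_def vec_eq_iff forall_2 quat_eq_iff quat_components)

lemma tangent_eq_iff: "tangent p w = tangent p' w' \<longleftrightarrow> p = p' \<and> w = w'"
  by (auto simp: tangent_def g_elem_eq_iff)

lemma tangent_linear:
  "0 = tangent 0 0"
  "tangent p w + tangent p' w' = tangent (p + p') (w + w')"
  "tangent p w - tangent p' w' = tangent (p - p') (w - w')"
  "t *\<^sub>R tangent p w = tangent (t *\<^sub>R p) (t *\<^sub>R w)"
  by (simp_all add: tangent_def g_elem_linear g_elem_eq_iff quat_eq_iff quat_components algebra_simps)

lemma isotropy_linear:
  "0 = isotropy 0 0"
  "isotropy p r + isotropy p' r' = isotropy (p + p') (r + r')"
  "t *\<^sub>R isotropy p r = isotropy (t *\<^sub>R p) (t *\<^sub>R r)"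
  by (simp_all add: isotropy_def g_elem_linear)

lemma quat_decomp: "q = qRe q *\<^sub>R 1 + qI q *\<^sub>R qi + qJ q *\<^sub>R qj + qK q *\<^sub>R qk"
  by (simp add: quat_eq_iff quat_components)

lemma mem_lie_h: "X \<in> lie_h \<longleftrightarrow> (\<exists>p r. X = isotropy p r \<and> qRe p = 0 \<and> qRe r = 0)"
proof
  let ?T = "{X. \<exists>p r. X = isotropy p r \<and> qRe p = 0 \<and> qRe r = 0}"
  have iso: "isotropy p r \<in> ?T" if "qRe p = 0" "qRe r = 0" for p r
    using that by blast
  have "subspace ?T"
  proof (rule subspaceI)
    show "0 \<in> ?T"
      unfolding isotropy_linear by (rule iso) (simp_all add: quat_components)
  next
    fix X Y assume "X \<in> ?T" "Y \<in> ?T"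
    then obtain p r p' r' where "X = isotropy p r" "Y = isotropy p' r'"
      "qRe p = 0" "qRe r = 0" "qRe p' = 0" "qRe r' = 0"
      by blast
    then show "X + Y \<in> ?T"
      by (simp only: isotropy_linear) (rule iso, simp_all add: quat_components)
  next
    fix t X assume "X \<in> ?T"
    then obtain p r where "X = isotropy p r" "qRe p = 0" "qRe r = 0"
      by blast
    then show "t *\<^sub>R X \<in> ?T"
      by (simp only: isotropy_linear) (rule iso, simp_all add: quat_components)
  qed
  moreover have "(qF q 2 2, 0) = isotropy 0 q" "(qF q 1 1, q) = isotropy q 0" for q
    by (simp_all add: isotropy_def qF_E12_g_elem)
  then have "{(qF q 2 2, 0) | q. q \<in> {qi, qj, qk}} \<union> {(qF q 1 1, q) | q. q \<in> {qi, qj, qk}} \<subseteq> ?T"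
    using iso by (auto simp only: Un_iff mem_Collect_eq insert_iff empty_iff quat_components)
  ultimately have "lie_h \<subseteq> ?T"
    unfolding lie_h_def by (rule span_minimal[rotated])
  then show "X \<in> lie_h \<Longrightarrow> \<exists>p r. X = isotropy p r \<and> qRe p = 0 \<and> qRe r = 0"
    by blast
next
  assume "\<exists>p r. X = isotropy p r \<and> qRe p = 0 \<and> qRe r = 0"
  then obtain p r where X: "X = isotropy p r" and pr: "qRe p = 0" "qRe r = 0" by blast
  have "(qF qi 2 2, 0) \<in> lie_h" "(qF qj 2 2, 0) \<in> lie_h" "(qF qk 2 2, 0) \<in> lie_h"
    "(qF qi 1 1, qi) \<in> lie_h" "(qF qj 1 1, qj) \<in> lie_h" "(qF qk 1 1, qk) \<in> lie_h"
    unfolding lie_h_def by (rule span_base, blast)+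
  then have "qI r *\<^sub>R isotropy 0 qi + qJ r *\<^sub>R isotropy 0 qj + qK r *\<^sub>R isotropy 0 qk
       + qI p *\<^sub>R isotropy qi 0 + qJ p *\<^sub>R isotropy qj 0 + qK p *\<^sub>R isotropy qk 0 \<in> lie_h"
    unfolding lie_h_def by (intro span_add span_scale) (simp_all add: isotropy_def qF_E12_g_elem)
  also have "qI r *\<^sub>R isotropy 0 qi + qJ r *\<^sub>R isotropy 0 qj + qK r *\<^sub>R isotropy 0 qk
       + qI p *\<^sub>R isotropy qi 0 + qJ p *\<^sub>R isotropy qj 0 + qK p *\<^sub>R isotropy qk 0 = X"
    using quat_decomp[of p] quat_decomp[of r] pr X by (simp add: isotropy_linear)
  finally show "X \<in> lie_h" .
qed

lemma mem_lie_m1: "X \<in> lie_m1 \<longleftrightarrow> (\<exists>p. X = tangent p 0 \<and> qRe p = 0)"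
proof
  let ?T = "{X. \<exists>p. X = tangent p 0 \<and> qRe p = 0}"
  have tan: "tangent p 0 \<in> ?T" if "qRe p = 0" for p
    using that by blast
  have "subspace ?T"
  proof (rule subspaceI)
    show "0 \<in> ?T"
      unfolding tangent_linear by (rule tan) (simp add: quat_components)
  next
    fix X Y assume "X \<in> ?T" "Y \<in> ?T"
    then obtain p p' where "X = tangent p 0" "Y = tangent p' 0" "qRe p = 0" "qRe p' = 0"
      by blast
    then show "X + Y \<in> ?T"
      by (simp only: tangent_linear add_0) (rule tan, simp add: quat_components)
  next
    fix t X assume "X \<in> ?T"
    then obtain p where "X = tangent p 0" "qRe p = 0"
      by blast
    then show "t *\<^sub>R X \<in> ?T"
      by (simp only: tangent_linear scaleR_zero_right) (rule tan, simp add: quat_components)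
  qed
  moreover have "(qF q 1 1, (- (3/2)) *\<^sub>R q) = tangent q 0" for q
    by (simp add: tangent_def qF_E12_g_elem)
  then have "{(qF q 1 1, (- (3/2)) *\<^sub>R q) | q. q \<in> {qi, qj, qk}} \<subseteq> ?T"
    using tan by (auto simp only: mem_Collect_eq insert_iff empty_iff quat_components)
  ultimately have "lie_m1 \<subseteq> ?T"
    unfolding lie_m1_def by (rule span_minimal[rotated])
  then show "X \<in> lie_m1 \<Longrightarrow> \<exists>p. X = tangent p 0 \<and> qRe p = 0"
    by blast
next
  assume "\<exists>p. X = tangent p 0 \<and> qRe p = 0"
  then obtain p where X: "X = tangent p 0" and p: "qRe p = 0" by blast
  have "(qF qi 1 1, (- (3/2)) *\<^sub>R qi) \<in> lie_m1" "(qF qj 1 1, (- (3/2)) *\<^sub>R qj) \<in> lie_m1"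
    "(qF qk 1 1, (- (3/2)) *\<^sub>R qk) \<in> lie_m1"
    unfolding lie_m1_def by (rule span_base, blast)+
  then have "qI p *\<^sub>R tangent qi 0 + qJ p *\<^sub>R tangent qj 0 + qK p *\<^sub>R tangent qk 0 \<in> lie_m1"
    unfolding lie_m1_def by (intro span_add span_scale) (simp_all add: tangent_def qF_E12_g_elem)
  also have "qI p *\<^sub>R tangent qi 0 + qJ p *\<^sub>R tangent qj 0 + qK p *\<^sub>R tangent qk 0 = X"
    using quat_decomp[of p] p X by (simp add: tangent_linear)
  finally show "X \<in> lie_m1" .
qed

lemma mem_lie_m2: "X \<in> lie_m2 \<longleftrightarrow> (\<exists>w. X = tangent 0 w)"
proof
  let ?T = "{X. \<exists>w. X = tangent 0 w}"
  have gens: "(qF qi 1 2, 0) = tangent 0 qi" "(qF qj 1 2, 0) = tangent 0 qj"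
    "(qF qk 1 2, 0) = tangent 0 qk" "(E12, 0) = tangent 0 1"
    by (simp_all add: tangent_def qF_E12_g_elem quat_components)
  {
    have "subspace ?T"
      by (rule subspaceI) (auto simp: tangent_linear tangent_eq_iff)
    moreover have "{(qF qj 1 2, 0), (qF qk 1 2, 0), (qF qi 1 2, 0), (E12, 0)} \<subseteq> ?T"
      unfolding gens by blast
    ultimately have "lie_m2 \<subseteq> ?T"
      unfolding lie_m2_def by (rule span_minimal[rotated])
    then show "X \<in> lie_m2 \<Longrightarrow> \<exists>w. X = tangent 0 w"
      by blast
  }
  assume "\<exists>w. X = tangent 0 w"
  then obtain w where X: "X = tangent 0 w" by blast
  have "tangent 0 qi \<in> lie_m2" "tangent 0 qj \<in> lie_m2" "tangent 0 qk \<in> lie_m2" "tangent 0 1 \<in> lie_m2"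
    unfolding lie_m2_def gens by (rule span_base, blast)+
  then have "qRe w *\<^sub>R tangent 0 1 + qI w *\<^sub>R tangent 0 qi + qJ w *\<^sub>R tangent 0 qj
      + qK w *\<^sub>R tangent 0 qk \<in> lie_m2"
    unfolding lie_m2_def by (intro span_add span_scale)
  also have "qRe w *\<^sub>R tangent 0 1 + qI w *\<^sub>R tangent 0 qi + qJ w *\<^sub>R tangent 0 qj
      + qK w *\<^sub>R tangent 0 qk = X"
    using quat_decomp[of w] X by (simp add: tangent_linear)
  finally show "X \<in> lie_m2" .
qed

lemma kappa_g_elem:
  "kappa (g_elem p w r z) (g_elem p' w' r' z') =
    12 * (qRe (p * p') - 2 * qdot w w' + qRe (r * r')) + 8 * qRe (z * z')"
  by (simp add: kappa_def g_elem_def trace_def matrix_matrix_mult_def sum_2 quat_components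
      qdot_def algebra_simps)

lemma mem_lie_m: "X \<in> lie_m \<longleftrightarrow> (\<exists>p w. X = tangent p w \<and> qRe p = 0)"
proof
  assume "X \<in> lie_m"
  then have g: "X \<in> lie_g" and orth: "\<And>p r. qRe p = 0 \<Longrightarrow> qRe r = 0 \<Longrightarrow> kappa X (isotropy p r) = 0"
    by (auto simp: lie_m_def mem_lie_h)
  from g obtain p w r z where X: "X = g_elem p w r z" "qRe p = 0" "qRe r = 0" "qRe z = 0"
    by (auto simp: mem_lie_g)
  \<comment> \<open>Testing against the six generators of the isotropy algebra gives six scalar equations.\<close>
  have "r = 0" "z = - (3/2) *\<^sub>R p"
    using orth[of qi 0] orth[of qj 0] orth[of qk 0] orth[of 0 qi] orth[of 0 qj] orth[of 0 qk] X
    by (simp_all add: isotropy_def kappa_g_elem qdot_def quat_eq_iff quat_components)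
  then show "\<exists>p w. X = tangent p w \<and> qRe p = 0"
    using X by (auto simp: tangent_def)
next
  assume "\<exists>p w. X = tangent p w \<and> qRe p = 0"
  then obtain p w where X: "X = tangent p w" "qRe p = 0" by blast
  have "X \<in> lie_g"
    using X by (simp add: mem_lie_g tangent_def g_elem_eq_iff quat_components)
  moreover have "kappa X (isotropy q r) = 0" if "qRe q = 0" "qRe r = 0" for q r
    using X that
    by (simp add: tangent_def isotropy_def kappa_g_elem qdot_def quat_components algebra_simps)
  ultimately show "X \<in> lie_m"
    by (auto simp: lie_m_def mem_lie_h)
qed

section \<open>Metric, brackets and the Nomizu map\<close>

lemma proj_m_tangent:
  assumes "qRe p = 0" "qRe q = 0" "qRe r = 0"
  shows "proj_m (tangent p w + isotropy q r) = tangent p w"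
  unfolding proj_m_def
proof (rule the_equality)
  show "tangent p w \<in> lie_m \<and> tangent p w + isotropy q r - tangent p w \<in> lie_h"
    using assms by (auto simp: mem_lie_m mem_lie_h)
next
  fix Y assume Y: "Y \<in> lie_m \<and> tangent p w + isotropy q r - Y \<in> lie_h"
  obtain p' w' where p': "Y = tangent p' w'" using Y by (auto simp: mem_lie_m)
  obtain q' r' where q': "tangent p w + isotropy q r - Y = isotropy q' r'"
    using Y by (auto simp: mem_lie_h)
  have "w = w'" and z: "p + q - p' = q'" "- (3/2) *\<^sub>R p + q + (3/2) *\<^sub>R p' = q'"
    using q' by (simp_all add: p' tangent_def isotropy_def g_elem_linear g_elem_eq_iff)
  \<comment> \<open>The entry at (1, 1) and the second component both determine \<open>q'\<close>; their difference isolates \<open>p\<close>.\<close>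
  from z have "(5/2) *\<^sub>R (p - p') = 0"
    by (simp add: quat_eq_iff quat_components)
  then show "Y = tangent p w"
    using p' \<open>w = w'\<close> by simp
qed

lemma proj_m1_tangent:
  assumes "qRe p = 0"
  shows "proj_m1 (tangent p w) = tangent p 0"
  unfolding proj_m1_def
  by (rule the_equality) (use assms in \<open>auto simp: mem_lie_m1 mem_lie_m2 tangent_linear tangent_eq_iff\<close>)

lemma proj_m2_tangent:
  assumes "qRe p = 0"
  shows "proj_m2 (tangent p w) = tangent 0 w"
  unfolding proj_m2_def
  by (rule the_equality) (use assms in \<open>auto simp: mem_lie_m1 mem_lie_m2 tangent_linear tangent_eq_iff\<close>)

lemma inv_metric_tangent:
  assumes "qRe p = 0" "qRe q = 0"
  shows "inv_metric a b (tangent p w) (tangent q v) = 30 * a * qdot p q + 24 * b * qdot w v"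
  using assms
  by (simp add: inv_metric_def proj_m1_tangent proj_m2_tangent)
     (simp add: tangent_def kappa_g_elem qdot_def quat_components algebra_simps)

lemma g_elem_matrix_mult:
  "fst (g_elem p w r z) ** fst (g_elem p' w' r' z') =
    (\<chi> m n. if m = 1 then if n = 1 then p * p' - qcnj w * w' else - (p * qcnj w') - qcnj w * r'
            else if n = 1 then w * p' + r * w' else r * r' - w * qcnj w')"
  by (simp add: g_elem_def matrix_matrix_mult_def vec_eq_iff forall_2 sum_2)

text \<open>
  The bracket of two tangent vectors, already split along \<open>\<hh> \<oplus> \<mm>\<close>. If its entry at \<open>(1, 1)\<close> is \<open>P\<close> and
  its second component is \<open>Z\<close>, then the \<open>\<mm>\<^sub>1\<close>-part is \<open>(2/5) (P - Z)\<close>; here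
  \<open>P = [p, q] - (qcnj w * v - qcnj v * w)\<close> and \<open>Z = (9/4) [p, q]\<close>.
\<close>

lemma bracket_tangent:
  assumes "qRe p = 0" "qRe q = 0"
  shows "bracket (tangent p w) (tangent q v) =
    tangent (- (1/2) *\<^sub>R (p * q - q * p) - (2/5) *\<^sub>R (qcnj w * v - qcnj v * w)) (w * q - v * p)
    + isotropy ((3/2) *\<^sub>R (p * q - q * p) - (3/5) *\<^sub>R (qcnj w * v - qcnj v * w)) (v * qcnj w - w * qcnj v)"
  unfolding bracket_def tangent_def isotropy_def g_elem_matrix_mult g_elem_linear
  using assms
  by (simp add: g_elem_def vec_eq_iff forall_2 quat_eq_iff quat_components field_simps)

lemma proj_m_bracket_tangent:
  assumes "qRe p = 0" "qRe q = 0"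
  shows "proj_m (bracket (tangent p w) (tangent q v)) =
    tangent (- (1/2) *\<^sub>R (p * q - q * p) - (2/5) *\<^sub>R (qcnj w * v - qcnj v * w)) (w * q - v * p)"
  unfolding bracket_tangent[OF assms]
  by (rule proj_m_tangent) (use assms in \<open>simp_all add: quat_components algebra_simps\<close>)

lemma bracket_isotropy:
  assumes "qRe p = 0" "qRe r = 0" "qRe q = 0"
  shows "bracket (isotropy p r) (tangent q v) = tangent (p * q - q * p) (r * v - v * p)"
  unfolding bracket_def tangent_def isotropy_def g_elem_matrix_mult g_elem_linear
  using assms
  by (simp add: g_elem_def vec_eq_iff forall_2 quat_eq_iff quat_components algebra_simps)

text \<open>
  The tensor \<open>U\<close> measures how far the metric is from being naturally reductive: it vanishes for \<open>a = b\<close>,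
  where the metric is a multiple of \<open>-kappa\<close> on \<open>\<mm>\<close>, and otherwise only pairs \<open>\<mm>\<^sub>1\<close> with \<open>\<mm>\<^sub>2\<close>. The formula comes
  from \<open>\<langle>x * p, v\<rangle> = \<langle>p, qcnj x * v\<rangle> = - \<langle>x, v * p\<rangle>\<close>, valid for imaginary \<open>p\<close>. Positive definiteness makes the
  solution of the defining equation unique.
\<close>

lemma U_map_tangent:
  assumes "qRe p = 0" "qRe q = 0" "a > 0" "b > 0"
  shows "U_map a b (tangent p w) (tangent q v) = tangent 0 (((a - b) / (2 * b)) *\<^sub>R (v * p + w * q))"
proof -
  let ?u = "((a - b) / (2 * b)) *\<^sub>R (v * p + w * q)"
  let ?Q = "\<lambda>V. \<forall>Z\<in>lie_m. 2 * inv_metric a b V Z =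
       inv_metric a b (proj_m (bracket Z (tangent p w))) (tangent q v) +
       inv_metric a b (tangent p w) (proj_m (bracket Z (tangent q v)))"
  have sol: "?Q (tangent 0 ?u)"
  proof
    fix Z assume "Z \<in> lie_m"
    then obtain s x where Z: "Z = tangent s x" "qRe s = 0" by (auto simp: mem_lie_m)
    have "inv_metric a b (proj_m (bracket Z (tangent p w))) (tangent q v) +
       inv_metric a b (tangent p w) (proj_m (bracket Z (tangent q v))) =
       24 * (a - b) * qdot (v * p + w * q) x"
      using assms Z(2) unfolding Z(1)
      by (simp add: proj_m_bracket_tangent inv_metric_tangent quat_components)
         (simp add: qdot_def quat_components algebra_simps)
    moreover have "inv_metric a b (tangent 0 ?u) Z = 24 * b * qdot ?u x"
      using Z(2) unfolding Z(1)
      by (simp add: inv_metric_tangent quat_components) (simp add: qdot_def quat_components)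
    moreover have "qdot ?u x = (a - b) / (2 * b) * qdot (v * p + w * q) x"
      by (rule qdot_scaleR_left)
    ultimately show "2 * inv_metric a b (tangent 0 ?u) Z =
       inv_metric a b (proj_m (bracket Z (tangent p w))) (tangent q v) +
       inv_metric a b (tangent p w) (proj_m (bracket Z (tangent q v)))"
      using \<open>b > 0\<close> by simp
  qed
  have unique: "V = tangent 0 ?u" if V: "V \<in> lie_m" "?Q V" for V
  proof -
    obtain s x where s: "V = tangent s x" "qRe s = 0" using V(1) by (auto simp: mem_lie_m)
    \<comment> \<open>The difference of the two solutions, used as a test vector against itself.\<close>
    define d where "d = x - ?u"
    have m: "tangent s d \<in> lie_m" using s by (auto simp: mem_lie_m)
    have "inv_metric a b V (tangent s d) = inv_metric a b (tangent 0 ?u) (tangent s d)"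
      using bspec[OF V(2) m] bspec[OF sol m] by simp
    then have "30 * a * qdot s s + 24 * b * qdot x d = 24 * b * qdot ?u d"
      using s(2) unfolding s(1) by (simp add: inv_metric_tangent quat_components) (simp add: qdot_def quat_components)
    then have "30 * a * qdot s s + 24 * b * qdot d d = 0"
      unfolding d_def qdot_diff_left[of x ?u] by (simp add: right_diff_distrib)
    moreover have "qdot s s \<ge> 0" "qdot d d \<ge> 0"
      by (simp_all add: qdot_def)
    ultimately have "qdot s s = 0" "qdot d d = 0"
      using assms by (simp_all add: add_nonneg_eq_0_iff)
    then have "s = 0" "d = 0"
      by (simp_all add: qdot_def quat_eq_iff quat_components add_nonneg_eq_0_iff)
    then show ?thesis using s by (simp add: d_def)
  qed
  show ?thesis
    unfolding U_map_def
    by (rule the_equality) (use sol unique in \<open>auto simp: mem_lie_m quat_components\<close>)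
qed

lemma Lambda_map_tangent:
  assumes "qRe p = 0" "qRe q = 0" "a > 0" "b > 0"
  shows "Lambda_map a b (tangent p w) (tangent q v) =
    tangent (- (1/4) *\<^sub>R (p * q - q * p) - (1/5) *\<^sub>R (qcnj w * v - qcnj v * w))
      ((1/2) *\<^sub>R (w * q - v * p) + ((a - b) / (2 * b)) *\<^sub>R (v * p + w * q))"
  unfolding Lambda_map_def U_map_tangent[OF assms] proj_m_bracket_tangent[OF assms(1,2)]
  by (simp add: tangent_linear tangent_eq_iff quat_eq_iff quat_components algebra_simps)

lemma e_vec_tangent:
  "e_vec a b 1 = tangent ((1 / sqrt (30 * a)) *\<^sub>R qi) 0"
  "e_vec a b 2 = tangent ((- 1 / sqrt (30 * a)) *\<^sub>R qk) 0"
  "e_vec a b 3 = tangent ((1 / sqrt (30 * a)) *\<^sub>R qj) 0"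
  "e_vec a b 4 = tangent 0 ((1 / sqrt (24 * b)) *\<^sub>R qj)"
  "e_vec a b 5 = tangent 0 ((1 / sqrt (24 * b)) *\<^sub>R qk)"
  "e_vec a b 6 = tangent 0 ((1 / sqrt (24 * b)) *\<^sub>R qi)"
  "e_vec a b 7 = tangent 0 ((1 / sqrt (24 * b)) *\<^sub>R 1)"
  by (simp_all add: e_vec_def onb_def qF_E12_g_elem quat_components tangent_def g_elem_linear
      g_elem_eq_iff quat_eq_iff)


section \<open>The Clifford action on the spinor\<close>

lemma wedge_linear:
  "wedge j (\<eta> + \<zeta>) = wedge j \<eta> + wedge j \<zeta>"
  "wedge j (\<eta> - \<zeta>) = wedge j \<eta> - wedge j \<zeta>"
  "wedge j (- \<eta>) = - wedge j \<eta>"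
  "wedge j (c *s \<eta>) = c *s wedge j \<eta>"
  "wedge j (t *\<^sub>R \<eta>) = t *\<^sub>R wedge j \<eta>"
  "wedge j 0 = 0"
  by (simp_all add: wedge_def vec_eq_iff algebra_simps)

lemma contr_linear:
  "contr j (\<eta> + \<zeta>) = contr j \<eta> + contr j \<zeta>"
  "contr j (\<eta> - \<zeta>) = contr j \<eta> - contr j \<zeta>"
  "contr j (- \<eta>) = - contr j \<eta>"
  "contr j (c *s \<eta>) = c *s contr j \<eta>"
  "contr j (t *\<^sub>R \<eta>) = t *\<^sub>R contr j \<eta>"
  "contr j 0 = 0"
  by (simp_all add: contr_def vec_eq_iff algebra_simps)

lemma cliff_e_scaleR: "cliff_e n (t *\<^sub>R \<eta>) = t *\<^sub>R cliff_e n \<eta>"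
  by (simp add: cliff_e_def wedge_linear contr_linear vec_eq_iff algebra_simps)

lemma cliff_e_1_linear:
  "cliff_e 1 (\<eta> + \<zeta>) = cliff_e 1 \<eta> + cliff_e 1 \<zeta>"
  "cliff_e 1 (\<eta> - \<zeta>) = cliff_e 1 \<eta> - cliff_e 1 \<zeta>"
  "cliff_e 1 (- \<eta>) = - cliff_e 1 \<eta>"
  "cliff_e 1 (c *s \<eta>) = c *s cliff_e 1 \<eta>"
  by (simp_all add: cliff_e_def vec_eq_iff algebra_simps)

lemma cliff_e_1_vac: "cliff_e 1 vac = \<i> *s vac"
  by (simp add: cliff_e_def vac_def axis_def vec_eq_iff)

text \<open>The first basis vector acts by the parity of the degree, which a wedge by \<open>y\<^sub>j\<close> reverses.\<close>

lemma cliff_e_1_wedge: "cliff_e 1 (wedge j \<eta>) = - wedge j (cliff_e 1 \<eta>)"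
proof -
  have "even (card S) \<longleftrightarrow> odd (card (S - {j}))" if "j \<in> S" for S
    using that card_Suc_Diff1[of S j] by (metis even_Suc finite)
  then show ?thesis
    by (auto simp: cliff_e_def wedge_def vec_eq_iff)
qed

lemma cliff_e_pairs:
  "cliff_e 2 \<eta> = \<i> *s (contr 1 \<eta> + wedge 1 \<eta>)" "cliff_e 3 \<eta> = wedge 1 \<eta> - contr 1 \<eta>"
  "cliff_e 4 \<eta> = \<i> *s (contr 2 \<eta> + wedge 2 \<eta>)" "cliff_e 5 \<eta> = wedge 2 \<eta> - contr 2 \<eta>"
  "cliff_e 6 \<eta> = \<i> *s (contr 3 \<eta> + wedge 3 \<eta>)" "cliff_e 7 \<eta> = wedge 3 \<eta> - contr 3 \<eta>"
  by (simp_all add: cliff_e_def)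

lemma wedge_same: "wedge j (wedge j \<eta>) = 0"
  by (simp add: wedge_def vec_eq_iff)

lemma distinct_3: "(1::3) \<noteq> 2" "(2::3) \<noteq> 1" "(1::3) \<noteq> 3" "(3::3) \<noteq> 1" "(2::3) \<noteq> 3" "(3::3) \<noteq> 2"
  by simp_all

text \<open>
  These rules move contractions inward until they meet the vacuum and sort the wedges into the order
  1, 2, 3, so that every spinor built from the vacuum reaches a normal form in the exterior basis.
\<close>

lemmas exterior_normalize =
  cliff_e_pairs cliff_e_1_linear cliff_e_1_wedge cliff_e_1_vac wedge_linear contr_linear
  contr_wedge contr_vac wedge_same distinct_3
  wedge_anticommute[of 2 1] wedge_anticommute[of 3 1] wedge_anticommute[of 3 2]

lemmas smult_normalize =
  vector_add_ldistrib vector_ssub_ldistrib vector_smult_assoc vector_sneg_minus1[symmetric]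
  vector_smult_rneg vector_smult_lneg vector_smult_rzero vector_smult_lid

text \<open>The vectors acting on \<open>sqrt 2\<close> times \<open>psi0\<close>, which keeps the coefficients Gaussian integers.\<close>

lemma cliff_e_psi0_unnormalized:
  fixes \<phi> defines "\<phi> \<equiv> wedge 2 (wedge 3 vac) + \<i> *s wedge 1 vac"
  shows
  "cliff_e 1 \<phi> = \<i> *s wedge 2 (wedge 3 vac) + wedge 1 vac"
  "cliff_e 2 \<phi> = \<i> *s wedge 1 (wedge 2 (wedge 3 vac)) - vac"
  "cliff_e 3 \<phi> = wedge 1 (wedge 2 (wedge 3 vac)) - \<i> *s vac"
  "cliff_e 4 \<phi> = \<i> *s wedge 3 vac + wedge 1 (wedge 2 vac)"
  "cliff_e 5 \<phi> = - wedge 3 vac - \<i> *s wedge 1 (wedge 2 vac)"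
  "cliff_e 6 \<phi> = - (\<i> *s wedge 2 vac) + wedge 1 (wedge 3 vac)"
  "cliff_e 7 \<phi> = wedge 2 vac - \<i> *s wedge 1 (wedge 3 vac)"
  by (simp_all add: \<phi>_def exterior_normalize smult_normalize del: One_nat_def)

text \<open>
  The cross product of the \<open>G\<^sub>2\<close>-structure defined by \<open>psi0\<close>. The signs are those of its three-form
  \<open>e\<^sub>1\<^sub>2\<^sub>3 - e\<^sub>1\<^sub>4\<^sub>5 - e\<^sub>1\<^sub>6\<^sub>7 - e\<^sub>2\<^sub>4\<^sub>6 + e\<^sub>2\<^sub>5\<^sub>7 - e\<^sub>3\<^sub>4\<^sub>7 - e\<^sub>3\<^sub>5\<^sub>6\<close>. In the proof, signs are first moved next to the
  spinors, so that both sides carry the same real factor.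
\<close>

lemma psi0_cross_product:
  "cliff_e 1 (cliff_e 2 psi0) = cliff_e 3 psi0" "cliff_e 1 (cliff_e 3 psi0) = - cliff_e 2 psi0"
  "cliff_e 1 (cliff_e 4 psi0) = - cliff_e 5 psi0" "cliff_e 1 (cliff_e 5 psi0) = cliff_e 4 psi0"
  "cliff_e 1 (cliff_e 6 psi0) = - cliff_e 7 psi0" "cliff_e 1 (cliff_e 7 psi0) = cliff_e 6 psi0"
  "cliff_e 2 (cliff_e 3 psi0) = cliff_e 1 psi0" "cliff_e 2 (cliff_e 4 psi0) = - cliff_e 6 psi0"
  "cliff_e 2 (cliff_e 5 psi0) = cliff_e 7 psi0" "cliff_e 2 (cliff_e 6 psi0) = cliff_e 4 psi0"
  "cliff_e 2 (cliff_e 7 psi0) = - cliff_e 5 psi0" "cliff_e 3 (cliff_e 4 psi0) = - cliff_e 7 psi0"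
  "cliff_e 3 (cliff_e 5 psi0) = - cliff_e 6 psi0" "cliff_e 3 (cliff_e 6 psi0) = cliff_e 5 psi0"
  "cliff_e 3 (cliff_e 7 psi0) = cliff_e 4 psi0" "cliff_e 4 (cliff_e 5 psi0) = - cliff_e 1 psi0"
  "cliff_e 4 (cliff_e 6 psi0) = - cliff_e 2 psi0" "cliff_e 4 (cliff_e 7 psi0) = - cliff_e 3 psi0"
  "cliff_e 5 (cliff_e 6 psi0) = - cliff_e 3 psi0" "cliff_e 5 (cliff_e 7 psi0) = cliff_e 2 psi0"
  "cliff_e 6 (cliff_e 7 psi0) = - cliff_e 1 psi0"
  unfolding psi0_def cliff_e_scaleR cliff_e_psi0_unnormalized scaleR_minus_right[symmetric]
  by (simp_all add: exterior_normalize smult_normalize del: One_nat_def)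

lemma cliff_e_square_psi0:
  "cliff_e 1 (cliff_e 1 psi0) = - psi0" "cliff_e 4 (cliff_e 4 psi0) = - psi0"
  unfolding psi0_def cliff_e_scaleR cliff_e_psi0_unnormalized scaleR_minus_right[symmetric]
  by (simp_all add: exterior_normalize smult_normalize del: One_nat_def)

lemma psi0_nonzero: "psi0 \<noteq> 0"
proof
  assume "psi0 = 0"
  then have "contr 1 psi0 = 0" by (simp add: contr_linear)
  then have "vac = 0"
    by (simp add: psi0_def exterior_normalize del: One_nat_def)
  then have "vac $ {} = 0" by simp
  then show False by (simp add: vac_def)
qed

lemma cliff_e_psi0_nonzero: "cliff_e 1 psi0 \<noteq> 0" "cliff_e 4 psi0 \<noteq> 0"
  using cliff_e_square_psi0 psi0_nonzero cliff_e_scaleR[of _ 0 psi0] by (metis neg_0_equal_iff_equal scaleR_zero_left)+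

lemma sum_1_7: "(\<Sum>n=1..7. f n) = f 1 + f 2 + f 3 + f 4 + f 5 + f 6 + f (7::nat)"
  by (simp add: eval_nat_numeral)

text \<open>
  By the cross product table, the coefficient of \<open>e\<^sub>k\<close> collects the three pairs \<open>m < n\<close> whose cross
  product is \<open>\<plusminus> e\<^sub>k\<close>. These seven forms cut out the stabilizer \<open>\<gg>\<^sub>2\<close> of \<open>psi0\<close> in \<open>\<ss>\<oo>(7)\<close>.
\<close>

lemma spin_lift_psi0:
  fixes T a b
  defines "\<tau> \<equiv> \<lambda>m n. inv_metric a b (T (e_vec a b m)) (e_vec a b n)"
  shows "spin_lift a b T psi0 = (1/2) *\<^sub>R (
      (\<tau> 2 3 - \<tau> 4 5 - \<tau> 6 7) *\<^sub>R cliff_e 1 psi0 +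
      (- \<tau> 1 3 - \<tau> 4 6 + \<tau> 5 7) *\<^sub>R cliff_e 2 psi0 +
      (\<tau> 1 2 - \<tau> 4 7 - \<tau> 5 6) *\<^sub>R cliff_e 3 psi0 +
      (\<tau> 1 5 + \<tau> 2 6 + \<tau> 3 7) *\<^sub>R cliff_e 4 psi0 +
      (- \<tau> 1 4 - \<tau> 2 7 + \<tau> 3 6) *\<^sub>R cliff_e 5 psi0 +
      (\<tau> 1 7 - \<tau> 2 4 - \<tau> 3 5) *\<^sub>R cliff_e 6 psi0 +
      (- \<tau> 1 6 + \<tau> 2 5 - \<tau> 3 4) *\<^sub>R cliff_e 7 psi0)"
proof -
  have above: "{1<..7} = {2, 3, 4, 5, 6, 7::nat}" "{2<..7} = {3, 4, 5, 6, 7::nat}"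
    "{3<..7} = {4, 5, 6, 7::nat}" "{4<..7} = {5, 6, 7::nat}" "{5<..7} = {6, 7::nat}"
    "{6<..7} = {7::nat}" "{7<..7} = ({} :: nat set)"
    by auto
  have "spin_lift a b T psi0 =
    (\<Sum>m=1..7. \<Sum>n\<in>{m<..7}. \<tau> m n *\<^sub>R ((1/2) *\<^sub>R cliff_e m (cliff_e n psi0)))"
    by (simp add: spin_lift_def \<tau>_def)
  also have "\<dots> = (1/2) *\<^sub>R (\<Sum>m=1..7. \<Sum>n\<in>{m<..7}. \<tau> m n *\<^sub>R cliff_e m (cliff_e n psi0))"
    by (simp add: scaleR_sum_right mult.commute)
  also have "(\<Sum>m=1..7. \<Sum>n\<in>{m<..7}. \<tau> m n *\<^sub>R cliff_e m (cliff_e n psi0)) =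
      (\<tau> 2 3 - \<tau> 4 5 - \<tau> 6 7) *\<^sub>R cliff_e 1 psi0 +
      (- \<tau> 1 3 - \<tau> 4 6 + \<tau> 5 7) *\<^sub>R cliff_e 2 psi0 +
      (\<tau> 1 2 - \<tau> 4 7 - \<tau> 5 6) *\<^sub>R cliff_e 3 psi0 +
      (\<tau> 1 5 + \<tau> 2 6 + \<tau> 3 7) *\<^sub>R cliff_e 4 psi0 +
      (- \<tau> 1 4 - \<tau> 2 7 + \<tau> 3 6) *\<^sub>R cliff_e 5 psi0 +
      (\<tau> 1 7 - \<tau> 2 4 - \<tau> 3 5) *\<^sub>R cliff_e 6 psi0 +
      (- \<tau> 1 6 + \<tau> 2 5 - \<tau> 3 4) *\<^sub>R cliff_e 7 psi0"
    unfolding sum_1_7 above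
    by (simp add: psi0_cross_product scaleR_left_distrib scaleR_left_diff_distrib del: One_nat_def)
  finally show ?thesis .
qed

section \<open>The Killing equation\<close>

lemma mult_divide_sqrt: "x > 0 \<Longrightarrow> x * (y / sqrt x) = sqrt x * y" for x y :: real
  by (simp add: field_simps)

lemma inv_metric_e_vec:
  assumes "qRe p = 0" "a > 0" "b > 0"
  shows
  "inv_metric a b (tangent p w) (e_vec a b 1) = sqrt (30 * a) * qI p"
  "inv_metric a b (tangent p w) (e_vec a b 2) = - sqrt (30 * a) * qK p"
  "inv_metric a b (tangent p w) (e_vec a b 3) = sqrt (30 * a) * qJ p"
  "inv_metric a b (tangent p w) (e_vec a b 4) = sqrt (24 * b) * qJ w"
  "inv_metric a b (tangent p w) (e_vec a b 5) = sqrt (24 * b) * qK w"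
  "inv_metric a b (tangent p w) (e_vec a b 6) = sqrt (24 * b) * qI w"
  "inv_metric a b (tangent p w) (e_vec a b 7) = sqrt (24 * b) * qRe w"
  using assms(1) mult_divide_sqrt[of "30 * a"] mult_divide_sqrt[of "24 * b"] assms(2,3)
  unfolding e_vec_tangent
  by (simp_all add: inv_metric_tangent quat_components qdot_def del: One_nat_def)

text \<open>
  The isotropy algebra acts by \<open>(q, v) \<mapsto> ([p, q], r * v - v * p)\<close>, a copy of \<open>\<ss>\<oo>(4)\<close> inside \<open>\<gg>\<^sub>2\<close>, so all
  seven forms vanish on it.
\<close>

lemma psi0_invariant:
  assumes "a > 0" "b > 0"
  shows "psi0 \<in> invariant_spinors a b"
proof -
  \<comment> \<open>In terms of the two roots all matrix entries are rational functions, so field arithmetic decides the claim.\<close>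
  define s where "s = sqrt (30 * a)"
  define t where "t = sqrt (24 * b)"
  have st: "s > 0" "t > 0" "a = s\<^sup>2 / 30" "b = t\<^sup>2 / 24"
    using assms by (simp_all add: s_def t_def)
  have roots: "sqrt (30 * a) = s" "sqrt (24 * b) = t"
    by (simp_all add: s_def t_def)
  have "spin_lift a b (bracket (isotropy p r)) psi0 = 0" if "qRe p = 0" "qRe r = 0" for p r
  proof -
    let ?\<tau> = "\<lambda>m n. inv_metric a b (bracket (isotropy p r) (e_vec a b m)) (e_vec a b n)"
    note expand = e_vec_tangent roots bracket_isotropy inv_metric_tangent qdot_def quat_components
    have
      "?\<tau> 2 3 - ?\<tau> 4 5 - ?\<tau> 6 7 = 0"
      "- ?\<tau> 1 3 - ?\<tau> 4 6 + ?\<tau> 5 7 = 0"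
      "?\<tau> 1 2 - ?\<tau> 4 7 - ?\<tau> 5 6 = 0"
      "?\<tau> 1 5 + ?\<tau> 2 6 + ?\<tau> 3 7 = 0"
      "- ?\<tau> 1 4 - ?\<tau> 2 7 + ?\<tau> 3 6 = 0"
      "?\<tau> 1 7 - ?\<tau> 2 4 - ?\<tau> 3 5 = 0"
      "- ?\<tau> 1 6 + ?\<tau> 2 5 - ?\<tau> 3 4 = 0"
      using that st(1,2)
      by (simp_all add: expand del: One_nat_def)
         (simp_all add: st(3,4) field_simps power2_eq_square)
    then show ?thesis
      unfolding spin_lift_psi0 by simp
  qed
  then show ?thesis
    by (auto simp: invariant_spinors_def mem_lie_h)
qed

lemma m2_eigenvalue:
  fixes a b :: real
  assumes "a > 0" "b > 0"
  shows "sqrt (3 * a) / (4 * b * sqrt 10) = 3 * a / (4 * b * sqrt (30 * a))"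
proof -
  have "sqrt (3 * a) * sqrt (30 * a) = sqrt ((3 * a)\<^sup>2 * 10)"
    by (simp add: power2_eq_square flip: real_sqrt_mult)
  also have "\<dots> = 3 * a * sqrt 10"
    using assms by (simp only: real_sqrt_mult real_sqrt_abs)
  finally show ?thesis
    using assms by (simp add: frac_eq_eq mult.commute)
qed

text \<open>
  Each of the seven forms, evaluated on \<open>\<Lambda>(X)\<close>, is a single coordinate of \<open>X\<close> times a constant. On \<open>\<mm>\<^sub>2\<close>
  its three terms are equal, and each contributes a third of the eigenvalue. On \<open>\<mm>\<^sub>1\<close> one term comes from
  \<open>ad p\<close> on \<open>\<mm>\<^sub>1\<close>, independent of \<open>a\<close> and \<open>b\<close> up to the normalization of \<open>X\<close>, and two equal ones from the
  action on \<open>\<mm>\<^sub>2\<close>.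
\<close>

lemma nabla_psi0:
  assumes "a > 0" "b > 0" "qRe p = 0"
  shows "nabla a b (tangent p w) psi0 =
    cliff a b (tangent (((2 * a - 5 * b) / (4 * b * sqrt (30 * a))) *\<^sub>R p)
      (- (sqrt (3 * a) / (4 * b * sqrt 10)) *\<^sub>R w)) psi0"
proof -
  define s where "s = sqrt (30 * a)"
  define t where "t = sqrt (24 * b)"
  have st: "s > 0" "t > 0" "a = s\<^sup>2 / 30" "b = t\<^sup>2 / 24"
    using assms by (simp_all add: s_def t_def)
  have roots: "sqrt (30 * a) = s" "sqrt (24 * b) = t"
    by (simp_all add: s_def t_def)
  have c2: "sqrt (3 * a) / (4 * b * sqrt 10) = 3 * s / (5 * t\<^sup>2)"
    unfolding m2_eigenvalue[OF assms(1,2)] roots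
    using st(1,2) by (simp add: st(3,4) field_simps power2_eq_square)
  have c1: "(2 * a - 5 * b) / (4 * b * s) = (8 * s\<^sup>2 - 25 * t\<^sup>2) / (20 * s * t\<^sup>2)"
    using st(1,2) by (simp add: st(3,4) field_simps)
  have c3: "(a - b) / (2 * b) = (4 * s\<^sup>2 - 5 * t\<^sup>2) / (10 * t\<^sup>2)"
    using st(1,2) by (simp add: st(3,4) field_simps)
  let ?\<tau> = "\<lambda>m n. inv_metric a b (Lambda_map a b (tangent p w) (e_vec a b m)) (e_vec a b n)"
  let ?c = "(8 * s\<^sup>2 - 25 * t\<^sup>2) / (20 * s * t\<^sup>2)"
  let ?d = "- (3 * s / (5 * t\<^sup>2))"
  note expand = e_vec_tangent roots Lambda_map_tangent inv_metric_tangent qdot_def quat_components c3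
  have coeffs:
    "(1/2) * (?\<tau> 2 3 - ?\<tau> 4 5 - ?\<tau> 6 7) = s * (?c * qI p)"
    "(1/2) * (- ?\<tau> 1 3 - ?\<tau> 4 6 + ?\<tau> 5 7) = - s * (?c * qK p)"
    "(1/2) * (?\<tau> 1 2 - ?\<tau> 4 7 - ?\<tau> 5 6) = s * (?c * qJ p)"
    "(1/2) * (?\<tau> 1 5 + ?\<tau> 2 6 + ?\<tau> 3 7) = t * (?d * qJ w)"
    "(1/2) * (- ?\<tau> 1 4 - ?\<tau> 2 7 + ?\<tau> 3 6) = t * (?d * qK w)"
    "(1/2) * (?\<tau> 1 7 - ?\<tau> 2 4 - ?\<tau> 3 5) = t * (?d * qI w)"
    "(1/2) * (- ?\<tau> 1 6 + ?\<tau> 2 5 - ?\<tau> 3 4) = t * (?d * qRe w)"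
    using assms st(1,2)
    by (simp_all add: expand del: One_nat_def)
       (simp_all add: st(3,4) field_simps power2_eq_square)
  show ?thesis
    unfolding nabla_def spin_lift_psi0 scaleR_add_right scaleR_scaleR coeffs
    unfolding cliff_def sum_1_7 roots c1 c2
    using assms by (simp add: inv_metric_e_vec quat_components roots del: One_nat_def)
qed

lemma cliff_tangent_axes:
  assumes "a > 0" "b > 0"
  shows "cliff a b (tangent (t *\<^sub>R qi) 0) \<eta> = (sqrt (30 * a) * t) *\<^sub>R cliff_e 1 \<eta>"
    and "cliff a b (tangent 0 (t *\<^sub>R qj)) \<eta> = (sqrt (24 * b) * t) *\<^sub>R cliff_e 4 \<eta>"
  unfolding cliff_def sum_1_7
  using assms by (simp_all add: inv_metric_e_vec quat_components del: One_nat_def)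

lemma killing_endo_tangent:
  assumes "qRe p = 0"
  shows "c1 *\<^sub>R proj_m1 (tangent p w) - c2 *\<^sub>R proj_m2 (tangent p w) =
    tangent (c1 *\<^sub>R p) (- c2 *\<^sub>R w)"
  using assms by (simp add: proj_m1_tangent proj_m2_tangent tangent_linear)

lemma symmetric_endo_split:
  "symmetric_endo a b (\<lambda>X. c1 *\<^sub>R proj_m1 X - c2 *\<^sub>R proj_m2 X)"
proof -
  let ?A = "\<lambda>X. c1 *\<^sub>R proj_m1 X - c2 *\<^sub>R proj_m2 X"
  have m: "tangent p w \<in> lie_m" if "qRe p = 0" for p w
    using that by (auto simp: mem_lie_m)
  have "?A X \<in> lie_m \<and> ?A (X + Y) = ?A X + ?A Y \<and> ?A (r *\<^sub>R X) = r *\<^sub>R ?A X \<and>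
      inv_metric a b (?A X) Y = inv_metric a b X (?A Y)"
    if XY: "X \<in> lie_m" "Y \<in> lie_m" for X Y r
  proof -
    obtain p w q v where [simp]: "X = tangent p w" "Y = tangent q v" "qRe p = 0" "qRe q = 0"
      using XY unfolding mem_lie_m by blast
    have 1: "qdot (- c2 *\<^sub>R w) v = qdot w (- c2 *\<^sub>R v)" "qdot (c1 *\<^sub>R p) q = qdot p (c1 *\<^sub>R q)"
      by (simp_all add: qdot_def quat_components)
    show ?thesis
      by (simp add: killing_endo_tangent m quat_components tangent_linear inv_metric_tangent
          tangent_eq_iff 1[simplified] scaleR_right_distrib mult.commute)
  qed
  then show ?thesis
    unfolding symmetric_endo_def by blast
qed

lemma symmetric_endo_homothety: "symmetric_endo a b (\<lambda>X. c *\<^sub>R X)"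
proof -
  have "c *\<^sub>R X \<in> lie_m \<and> inv_metric a b (c *\<^sub>R X) Y = inv_metric a b X (c *\<^sub>R Y)"
    if XY: "X \<in> lie_m" "Y \<in> lie_m" for X Y
  proof -
    obtain p w q v where [simp]: "X = tangent p w" "Y = tangent q v" "qRe p = 0" "qRe q = 0"
      using XY unfolding mem_lie_m by blast
    show ?thesis
      by (auto simp: mem_lie_m tangent_linear tangent_eq_iff inv_metric_tangent quat_components)
         (simp add: qdot_def quat_components algebra_simps)
  qed
  then show ?thesis
    unfolding symmetric_endo_def by (simp add: scaleR_right_distrib mult.commute)
qed

lemma generalized_killing_psi0:
  assumes "a > 0" "b > 0"
  shows "generalized_killing_for a b
      (\<lambda>X. ((2 * a - 5 * b) / (4 * b * sqrt (30 * a))) *\<^sub>R proj_m1 X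
         - (sqrt (3 * a) / (4 * b * sqrt 10)) *\<^sub>R proj_m2 X) psi0"
  unfolding generalized_killing_for_def
proof (intro conjI ballI symmetric_endo_split)
  fix X assume "X \<in> lie_m"
  then obtain p w where X: "X = tangent p w" "qRe p = 0"
    by (auto simp: mem_lie_m)
  show "nabla a b X psi0 = cliff a b
      (((2 * a - 5 * b) / (4 * b * sqrt (30 * a))) *\<^sub>R proj_m1 X
         - (sqrt (3 * a) / (4 * b * sqrt 10)) *\<^sub>R proj_m2 X) psi0"
    unfolding X(1) killing_endo_tangent[OF X(2)] by (rule nabla_psi0[OF assms X(2)])
qed

lemma eigenvalues_eq_iff:
  fixes a b :: real
  assumes "a > 0" "b > 0"
  shows "(2 * a - 5 * b) / (4 * b * sqrt (30 * a)) = - (sqrt (3 * a) / (4 * b * sqrt 10)) \<longleftrightarrow> a = b"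
proof -
  have "(2 * a - 5 * b) / (4 * b * sqrt (30 * a)) = - (sqrt (3 * a) / (4 * b * sqrt 10)) \<longleftrightarrow>
      (2 * a - 5 * b) / (4 * b * sqrt (30 * a)) = (- (3 * a)) / (4 * b * sqrt (30 * a))"
    using m2_eigenvalue[OF assms] by simp
  also have "\<dots> \<longleftrightarrow> 2 * a - 5 * b = - (3 * a)"
    using assms by (subst divide_cancel_right) simp
  also have "\<dots> \<longleftrightarrow> a = b" by auto
  finally show ?thesis .
qed

lemma riemannian_killing_psi0_iff:
  assumes "a > 0" "b > 0"
  shows "riemannian_killing a b psi0 \<longleftrightarrow> a = b"
proof -
  define l1 where "l1 = (2 * a - 5 * b) / (4 * b * sqrt (30 * a))"
  define l2 where "l2 = sqrt (3 * a) / (4 * b * sqrt 10)"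
  have nabla: "nabla a b (tangent p w) psi0 = cliff a b (tangent (l1 *\<^sub>R p) (- l2 *\<^sub>R w)) psi0"
    if "qRe p = 0" for p w
    unfolding l1_def l2_def by (rule nabla_psi0[OF assms that])
  have "riemannian_killing a b psi0 \<longleftrightarrow> l1 = - l2"
  proof
    assume "riemannian_killing a b psi0"
    then obtain c where c: "\<And>X. X \<in> lie_m \<Longrightarrow> nabla a b X psi0 = cliff a b (c *\<^sub>R X) psi0"
      by (auto simp: riemannian_killing_def generalized_killing_for_def)
    have "tangent qi 0 \<in> lie_m" "tangent 0 qj \<in> lie_m"
      by (auto simp: mem_lie_m quat_components)
    \<comment> \<open>One direction in each summand shows both eigenvalues.\<close>
    from this[THEN c]
    have "cliff a b (tangent (l1 *\<^sub>R qi) 0) psi0 = cliff a b (tangent (c *\<^sub>R qi) 0) psi0"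
      "cliff a b (tangent 0 (- l2 *\<^sub>R qj)) psi0 = cliff a b (tangent 0 (c *\<^sub>R qj)) psi0"
      by (simp_all add: nabla quat_components tangent_linear)
    then show "l1 = - l2"
      using assms cliff_e_psi0_nonzero
      unfolding cliff_tangent_axes[OF assms] scaleR_cancel_right mult_cancel_left by simp
  next
    assume eq: "l1 = - l2"
    have "generalized_killing_for a b (\<lambda>X. l1 *\<^sub>R X) psi0"
      unfolding generalized_killing_for_def
    proof
      show "symmetric_endo a b (\<lambda>X. l1 *\<^sub>R X)"
        by (rule symmetric_endo_homothety)
      show "\<forall>X\<in>lie_m. nabla a b X psi0 = cliff a b (l1 *\<^sub>R X) psi0"
      proof
        fix X assume "X \<in> lie_m"
        then obtain p w where X: "X = tangent p w" "qRe p = 0"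
          unfolding mem_lie_m by blast
        show "nabla a b X psi0 = cliff a b (l1 *\<^sub>R X) psi0"
          using nabla[OF X(2), of w] unfolding X(1) tangent_linear eq[symmetric] .
      qed
    qed
    then show "riemannian_killing a b psi0"
      unfolding riemannian_killing_def by blast
  qed
  then show ?thesis
    unfolding l1_def l2_def using eigenvalues_eq_iff[OF assms] by simp
qed

lemma inv_metric_proportional_iff:
  assumes "a > 0" "b > 0"
  shows "(\<exists>c>0. \<forall>X\<in>lie_m. \<forall>Y\<in>lie_m. inv_metric a b X Y = c * second_einstein_metric X Y) \<longleftrightarrow> a = b"
proof
  assume "\<exists>c>0. \<forall>X\<in>lie_m. \<forall>Y\<in>lie_m. inv_metric a b X Y = c * second_einstein_metric X Y"
  then obtain c where c: "\<And>X. X \<in> lie_m \<Longrightarrow> inv_metric a b X X = c * second_einstein_metric X X"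
    by blast
  have "tangent qi 0 \<in> lie_m" "tangent 0 qj \<in> lie_m"
    by (auto simp: mem_lie_m quat_components)
  \<comment> \<open>The two directions give \<open>30 * a = c * 30 / 24\<close> and \<open>24 * b = c\<close>.\<close>
  from this[THEN c] show "a = b"
    by (simp add: second_einstein_metric_def inv_metric_tangent quat_components qdot_def)
next
  assume "a = b"
  then have "inv_metric a b X Y = (24 * a) * second_einstein_metric X Y" for X Y
    by (simp add: second_einstein_metric_def inv_metric_def algebra_simps)
  then show "\<exists>c>0. \<forall>X\<in>lie_m. \<forall>Y\<in>lie_m. inv_metric a b X Y = c * second_einstein_metric X Y"
    using assms by (intro exI[of _ "24 * a"]) simp
qed

theorem proposition4p29:
  fixes a b :: real
  assumes "a > 0" and "b > 0"
  shows "psi0 \<in> invariant_spinors a b \<and>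
    generalized_killing_for a b
      (\<lambda>X. ((2 * a - 5 * b) / (4 * b * sqrt (30 * a))) *\<^sub>R proj_m1 X
         - (sqrt (3 * a) / (4 * b * sqrt 10)) *\<^sub>R proj_m2 X) psi0 \<and>
    (riemannian_killing a b psi0 \<longleftrightarrow> a = b) \<and>
    (riemannian_killing a b psi0 \<longleftrightarrow>
      (\<exists>c>0. \<forall>X\<in>lie_m. \<forall>Y\<in>lie_m. inv_metric a b X Y = c * second_einstein_metric X Y))"
  using psi0_invariant[OF assms] generalized_killing_psi0[OF assms]
    riemannian_killing_psi0_iff[OF assms] inv_metric_proportional_iff[OF assms]
  by simp

end
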